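(* Let $N\in\mathbb{N}^+$ and $K=(K_1,K_2,\dots,K_N)\in\mathbb{S}^N$. Then $$K_N\zeta(K)=\zeta(K)\sigma_N,$$ where $K_N\zeta(K)=(K_NK(1),K_NK(2),\dots,K_NK(2^N))$, and $\sigma_N:=(\sigma^{(N)}_{\imath,\jmath})_{2^N\times2^N}\in M_{2^N}(\mathbb{R})$ is given by $$\sigma^{(N)}_{\imath,\jmath}:=\begin{cases}(-1)^{N+\jmath},&\imath+\jmath=2^N+1,\\0,&\text{otherwise},\end{cases}$$ for each $\imath,\jmath\in\{1,2,\dots,2^N\}$.
   Context: $\mathbb{S}=\{q\in\mathbb{H}:q^2=-1\}$, $\mathbb{H}$ the quaternions. For $K=(K_1,\dots,K_N)\in\mathbb{S}^N$ and $m\in\{1,\dots,2^N\}$, let $(m_Nm_{N-1}\cdots m_1)_2$ be the binary expansion of $m-1$, set $K_0:=1$ and $$K(m):=(K_NK_{N-1})^{m_N}(K_{N-1}K_{N-2})^{m_{N-1}}\cdots(K_1K_0)^{m_1}.$$ The row vector $\zeta(K)\in\mathbb{H}^{2^N}$ is $\zeta(K):=(K(1),K(2),\dots,K(2^N))$. *)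

theory Defs
  imports Complex_Main "HOL-Library.FuncSet" "Jordan_Normal_Form.Matrix"
begin

section \<open>The real algebra of quaternions\<close>

text \<open>\<open>Quat a b c d\<close> is \<open>a + b i + c j + d k\<close>, with \<open>i * j = k\<close>.\<close>

datatype quat = Quat (q_re: real) (q_i: real) (q_j: real) (q_k: real)

instantiation quat :: real_algebra_1
begin

definition "0 = Quat 0 0 0 0"

definition "1 = Quat 1 0 0 0"

definition "p + q =
  Quat (q_re p + q_re q) (q_i p + q_i q) (q_j p + q_j q) (q_k p + q_k q)"

definition "- q = Quat (- q_re q) (- q_i q) (- q_j q) (- q_k q)"

definition "p - q =
  Quat (q_re p - q_re q) (q_i p - q_i q) (q_j p - q_j q) (q_k p - q_k q)"

definition "p * q = Quat
  (q_re p * q_re q - q_i p * q_i q - q_j p * q_j q - q_k p * q_k q)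
  (q_re p * q_i q + q_i p * q_re q + q_j p * q_k q - q_k p * q_j q)
  (q_re p * q_j q - q_i p * q_k q + q_j p * q_re q + q_k p * q_i q)
  (q_re p * q_k q + q_i p * q_j q - q_j p * q_i q + q_k p * q_re q)"

definition "r *\<^sub>R q = Quat (r * q_re q) (r * q_i q) (r * q_j q) (r * q_k q)"

instance
  by standard
    (simp_all add: zero_quat_def one_quat_def plus_quat_def uminus_quat_def
      minus_quat_def times_quat_def scaleR_quat_def algebra_simps)

end

section \<open>Imaginary units and the vector \<open>\<zeta>(K)\<close>\<close>

definition imag_units :: "quat set"  (\<open>\<S>\<close>)
  where "\<S> = {q. q\<^sup>2 = -1}"

text \<open>The digit \<open>m_k\<close> in \<open>(m_N \<dots> m_1)_2 = m - 1\<close>; the least significant one is \<open>k = 1\<close>.\<close>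

definition bin_digit :: "nat \<Rightarrow> nat \<Rightarrow> nat"
  where "bin_digit m k = ((m - 1) div 2 ^ (k - 1)) mod 2"

text \<open>
  A tuple \<open>(K_1, \<dots>, K_N)\<close> is a function of which only the values on \<open>{1..N}\<close> are
  relevant; the convention \<open>K_0 = 1\<close> is imposed here by the update at \<open>0\<close>. The factors
  do not commute and are multiplied with \<open>k = N\<close> leftmost and \<open>k = 1\<close> rightmost.
\<close>

definition K_prod :: "nat \<Rightarrow> (nat \<Rightarrow> quat) \<Rightarrow> nat \<Rightarrow> quat"
  where "K_prod N K m =
    (let K' = K(0 := 1)
     in prod_list (map (\<lambda>k. (K' k * K' (k - 1)) ^ bin_digit m k) (rev [1..<N + 1])))"

text \<open>Matrix entries are indexed from \<open>0\<close> in the library, hence the shifts by one below.\<close>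

definition zeta :: "nat \<Rightarrow> (nat \<Rightarrow> quat) \<Rightarrow> quat mat"
  where "zeta N K = mat 1 (2 ^ N) (\<lambda>(_, j). K_prod N K (j + 1))"

definition sigma :: "nat \<Rightarrow> real mat"
  where "sigma N = mat (2 ^ N) (2 ^ N)
    (\<lambda>(i, j). if (i + 1) + (j + 1) = 2 ^ N + 1 then (-1) ^ (N + (j + 1)) else 0)"

end

theory Submission
  imports Defs
begin

text \<open>
  Entrywise the claim says that left multiplication by \<open>K_N\<close> sends \<open>K(m)\<close> to
  \<open>\<plusminus> K(2^N + 1 - m)\<close>, the index whose binary digits are all flipped. This goes by induction on
  \<open>N\<close>, using the leading digit: \<open>K_(N+1) = -(K_(N+1) K_N) K_N\<close> inserts the leading factor
  \<open>K_(N+1) K_N\<close> when it is absent, and \<open>K_(N+1) (K_(N+1) K_N) = - K_N\<close> removes it when it is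
  present; the remaining \<open>K_N\<close> flips the lower digits.
\<close>

lemma imag_units_mult_self: "q \<in> \<S> \<Longrightarrow> q * q = -1"
  by (simp add: imag_units_def power2_eq_square)

lemma bin_digit_less_two_power:
  assumes "n < 2 ^ N"
  shows "bin_digit (Suc n) (Suc N) = 0"
  using assms by (simp add: bin_digit_def)

lemma bin_digit_two_power_add_top:
  assumes "n < 2 ^ N"
  shows "bin_digit (Suc (2 ^ N + n)) (Suc N) = 1"
  using assms by (simp add: bin_digit_def)

text \<open>For \<open>k \<le> N\<close>, \<open>2 ^ N\<close> is an even multiple of
  \<open>2 ^ (k - 1)\<close>, so it changes the quotient by an even number.\<close>

lemma bin_digit_two_power_add_low:
  assumes "k \<in> {1..N}"
  shows "bin_digit (Suc (2 ^ N + n)) k = bin_digit (Suc n) k"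
proof -
  from assms obtain d where d: "N = k - 1 + Suc d"
    by (metis One_nat_def Suc_diff_1 Suc_le_eq add_Suc_right add_Suc atLeastAtMost_iff le_Suc_ex)
  have "(2 ^ N + n) div 2 ^ (k - 1) = n div 2 ^ (k - 1) + 2 * 2 ^ d"
    using div_mult_self1[of "2 ^ (k - 1)" n "2 * 2 ^ d"]
    unfolding d by (simp add: power_add ac_simps)
  then show ?thesis
    by (simp add: bin_digit_def)
qed

text \<open>The reversed list puts the factor for the leading digit on the left. The case
  \<open>N = 0\<close> is the convention \<open>K_0 = 1\<close>, since \<open>K 0\<close> itself is
  arbitrary.\<close>

lemma K_prod_Suc:
  "K_prod (Suc N) K m =
    (K (Suc N) * (if N = 0 then 1 else K N)) ^ bin_digit m (Suc N) * K_prod N K m"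
  by (simp add: K_prod_def)

lemma K_prod_Suc_less:
  assumes "n < 2 ^ N"
  shows "K_prod (Suc N) K (Suc n) = K_prod N K (Suc n)"
  using bin_digit_less_two_power[OF assms] by (simp add: K_prod_Suc)

lemma K_prod_Suc_two_power_add:
  assumes "n < 2 ^ N" and "N \<ge> 1"
  shows "K_prod (Suc N) K (Suc (2 ^ N + n)) = K (Suc N) * K N * K_prod N K (Suc n)"
proof -
  have "K_prod N K (Suc (2 ^ N + n)) = K_prod N K (Suc n)"
    unfolding K_prod_def Let_def
    by (intro arg_cong[of _ _ prod_list] map_cong refl arg_cong[of _ _ "(^) _"]
        bin_digit_two_power_add_low) auto
  then show ?thesis
    using assms bin_digit_two_power_add_top[OF assms(1)] by (simp add: K_prod_Suc)
qed

lemma mult_K_prod: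
  assumes "N \<ge> 1" and "K \<in> {1..N} \<rightarrow> \<S>" and "n < 2 ^ N"
  shows "K N * K_prod N K (Suc n) = (-1) ^ (N + Suc n) * K_prod N K (2 ^ N - n)"
  using assms
proof (induction N arbitrary: n rule: nat_induct_at_least)
  case base
  then have "K 1 * K 1 = -1"
    by (intro imag_units_mult_self) auto
  moreover from base have "n = 0 \<or> n = 1"
    by auto
  ultimately show ?case
    by (auto simp: K_prod_def bin_digit_def)
next
  case (Suc N)
  have sq: "K N * K N = -1" "K (Suc N) * K (Suc N) = -1"
    using Suc.prems(1) Suc.hyps by (auto intro!: imag_units_mult_self)
  have IH: "K N * K_prod N K (Suc r) = (-1) ^ (N + Suc r) * K_prod N K (2 ^ N - r)"
    if "r < 2 ^ N" for r
    using Suc.prems(1) that by (intro Suc.IH) auto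
  show ?case
  proof (cases "n < 2 ^ N")
    case True
    \<comment> \<open>Since \<open>n + r = 2 ^ N - 1\<close>, \<open>r\<close> is \<open>n\<close>
      with its \<open>N\<close> lower digits flipped.\<close>
    define r where "r = 2 ^ N - Suc n"
    have r: "r < 2 ^ N" "2 ^ Suc N - n = Suc (2 ^ N + r)" "2 ^ N - n = Suc r"
      using True by (auto simp: r_def)
    have "K (Suc N) * K_prod (Suc N) K (Suc n) = - (K (Suc N) * (K N * K N) * K_prod N K (Suc n))"
      using True by (simp add: K_prod_Suc_less sq)
    also have "\<dots> = - (K (Suc N) * K N * ((-1) ^ (N + Suc n) * K_prod N K (Suc r)))"
      using IH[OF True] r(3) by (simp only: mult.assoc)
    also have "\<dots> = (-1) ^ (Suc N + Suc n) * (K (Suc N) * K N * K_prod N K (Suc r))"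
      \<comment> \<open>The sign is 1 or -1, hence central; splitting on parity lets it pass the
        non-commuting factors.\<close>
      by (cases "even (N + Suc n)") auto
    finally show ?thesis
      using r Suc.hyps by (simp only: K_prod_Suc_two_power_add)
  next
    case False
    \<comment> \<open>Here \<open>r\<close> is \<open>n\<close> without its leading digit 1.\<close>
    define r where "r = n - 2 ^ N"
    have r: "r < 2 ^ N" "n = 2 ^ N + r" "2 ^ Suc N - n = Suc (2 ^ N - Suc r)"
      "2 ^ N - r = Suc (2 ^ N - Suc r)"
      using False Suc.prems(2) by (auto simp: r_def)
    have "K (Suc N) * K_prod (Suc N) K (Suc n) =
        K (Suc N) * K (Suc N) * (K N * K_prod N K (Suc r))"
      using r Suc.hyps by (simp add: K_prod_Suc_two_power_add mult.assoc)
    also have "\<dots> = (-1) ^ Suc (N + Suc r) * K_prod N K (2 ^ N - r)"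
      using IH[OF r(1)] by (simp add: sq)
    \<comment> \<open>The exponents differ by \<open>2 ^ N\<close>, which is even because
      \<open>N \<ge> 1\<close>.\<close>
    also have "(-1) ^ Suc (N + Suc r) = ((-1) ^ (Suc N + Suc n) :: quat)"
      unfolding r(2) using Suc.hyps by (simp add: power_add)
    also have "K_prod N K (2 ^ N - r) = K_prod (Suc N) K (2 ^ Suc N - n)"
      unfolding r(3,4) by (rule K_prod_Suc_less[symmetric]) simp
    finally show ?thesis .
  qed
qed

theorem lemma10p3:
  fixes N :: nat and K :: "nat \<Rightarrow> quat"
  assumes "N \<ge> 1"
    and "K \<in> {1..N} \<rightarrow> \<S>"
  shows "K N \<cdot>\<^sub>m zeta N K = zeta N K * map_mat of_real (sigma N)"
proof (rule eq_matI)
  fix i j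
  assume "i < dim_row (zeta N K * map_mat of_real (sigma N))"
    and "j < dim_col (zeta N K * map_mat of_real (sigma N))"
  then have i: "i = 0" and j: "j < 2 ^ N"
    by (auto simp: zeta_def sigma_def)
  \<comment> \<open>The row of the only nonzero entry in column \<open>j\<close>: counted from 0,
    the antidiagonal is \<open>l + j + 1 = 2 ^ N\<close>.\<close>
  define l where "l = 2 ^ N - Suc j"
  have l: "l < 2 ^ N" "Suc l = 2 ^ N - j"
    using j by (auto simp: l_def)
  have "(zeta N K * map_mat of_real (sigma N)) $$ (i, j) =
      (\<Sum>k = 0..<2 ^ N. K_prod N K (Suc k) * of_real (sigma N $$ (k, j)))"
    using i j by (simp add: zeta_def sigma_def scalar_prod_def)
  also have "\<dots> = (\<Sum>k = 0..<2 ^ N. if k = l then K_prod N K (Suc l) * (-1) ^ (N + Suc j) else 0)"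
    using j by (intro sum.cong refl) (auto simp: sigma_def l_def)
  also have "\<dots> = K_prod N K (Suc l) * (-1) ^ (N + Suc j)"
    using l(1) by simp
  also have "\<dots> = (-1) ^ (N + Suc j) * K_prod N K (2 ^ N - j)"
    unfolding l(2) by (cases "even (N + Suc j)") auto
  also have "\<dots> = K N * K_prod N K (Suc j)"
    by (rule mult_K_prod[OF assms j, symmetric])
  finally show "(K N \<cdot>\<^sub>m zeta N K) $$ (i, j) = (zeta N K * map_mat of_real (sigma N)) $$ (i, j)"
    using i j by (simp add: zeta_def)
qed (simp_all add: zeta_def sigma_def)

end
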